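(* Let $\mathscr{R}\subset M_2(\mathbb{C})$ be the space of matrices $\begin{pmatrix} z_1&z_2\\0&0\end{pmatrix}$ and $\mathscr{D}\subset M_2(\mathbb{C})$ the space of matrices $\begin{pmatrix} z_1&0\\0&z_2\end{pmatrix}$, $z_1,z_2\in\mathbb{C}$. For $\mathscr{S}\in\{\mathscr{R},\mathscr{D}\}$ let $$\mathcal{A}_{\mathscr{S}}=\left\{\begin{pmatrix}\lambda I_{\mathbb{C}^2}&s\\0&\lambda I_{\mathbb{C}^2}\end{pmatrix}:\lambda\in\mathbb{C},\ s\in\mathscr{S}\right\}\subset M_4(\mathbb{C}),$$ which is a commutative unital subalgebra of $M_4(\mathbb{C})$. Let $\psi:\mathscr{R}\to\mathscr{D}$ be given by $\psi\begin{pmatrix} z_1&z_2\\0&0\end{pmatrix}=\begin{pmatrix} z_1&0\\0&z_2\end{pmatrix}$ and define $\Psi:\mathcal{A}_{\mathscr{R}}\to\mathcal{A}_{\mathscr{D}}$ by $$\Psi\begin{pmatrix}\lambda I_{\mathbb{C}^2}&s\\0&\lambda I_{\mathbb{C}^2}\end{pmatrix}=\begin{pmatrix}\lambda I_{\mathbb{C}^2}&\psi(s)\\0&\lambda I_{\mathbb{C}^2}\end{pmatrix}.$$ Then $\Psi$ is a unital completely bounded isomorphism, and there exist no invertible matrices $X,Y\in M_4(\mathbb{C})$ such that $$\|XaX^{-1}\|=\|Y\Psi(a)Y^{-1}\|\quad\text{for every } a\in\mathcal{A}_{\mathscr{R}}.$$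
   Context: $M_n(\mathbb{C})=B(\mathbb{C}^n)$ carries the operator norm, and subalgebras carry the inherited matrix norms. A unital completely bounded isomorphism is a bijective unital completely bounded algebra homomorphism whose inverse is also completely bounded. *)

theory Defs
  imports "HOL-Analysis.Analysis"
begin

text \<open>The norm of \<^typ>\<open>complex^'n\<close> is the Euclidean norm, so \<^const>\<open>onorm\<close> of the associated
  map on column vectors is the operator norm. The norm that the library puts on the type
  \<^typ>\<open>complex^'n^'n\<close> itself is the Frobenius norm and is not used.\<close>

definition op_norm :: "complex^'n^'n \<Rightarrow> real" where
  "op_norm a = onorm (\<lambda>v. a *v v)"

text \<open>The matrix norms: \<open>amp_norm k x\<close> is the operator norm of the \<open>k \<times> k\<close> block matrix with blocks
  \<open>x i j\<close> for \<open>i, j < k\<close>, acting on the \<open>k\<close>-fold Hilbert space direct sum of \<open>\<complex>\<^sup>n\<close>. The size \<open>k\<close>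
  has to be quantified over, so it is a natural number and not a type.\<close>

definition amp_norm :: "nat \<Rightarrow> (nat \<Rightarrow> nat \<Rightarrow> complex^'n^'n) \<Rightarrow> real" where
  "amp_norm k x =
     Sup {sqrt (\<Sum>i<k. (norm (\<Sum>j<k. x i j *v v j))\<^sup>2) | v. (\<Sum>j<k. (norm (v j))\<^sup>2) \<le> 1}"

lemma bounded_linear_matvec: "bounded_linear (\<lambda>v. (a :: complex^'n^'n) *v v)"
proof (intro linear_conv_bounded_linear[THEN iffD1] linearI)
  show "a *v (x + y) = a *v x + a *v y" for x y
    by (rule matrix_vector_right_distrib)
  show "a *v (r *\<^sub>R x) = r *\<^sub>R (a *v x)" for r x
    by (simp add: matrix_vector_mult_def vec_eq_iff scaleR_sum_right)
qed

lemma amp_norm_bdd_above: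
  fixes x :: "nat \<Rightarrow> nat \<Rightarrow> complex^'n^'n"
  shows "bdd_above {sqrt (\<Sum>i<k. (norm (\<Sum>j<k. x i j *v v j))\<^sup>2) | v. (\<Sum>j<k. (norm (v j))\<^sup>2) \<le> 1}"
proof (rule bdd_aboveI, clarify)
  fix v :: "nat \<Rightarrow> complex^'n" assume v: "(\<Sum>j<k. (norm (v j))\<^sup>2) \<le> 1"
  have v1: "norm (v j) \<le> 1" if "j < k" for j
  proof -
    have "(norm (v j))\<^sup>2 \<le> (\<Sum>j<k. (norm (v j))\<^sup>2)"
      by (rule member_le_sum) (use that in auto)
    with v have "(norm (v j))\<^sup>2 \<le> 1" by linarith
    then show ?thesis by (simp add: power_le_one_iff)
  qed
  have *: "norm (\<Sum>j<k. x i j *v v j) \<le> (\<Sum>j<k. op_norm (x i j))" for i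
  proof (rule sum_norm_le)
    fix j assume "j \<in> {..<k}"
    then have "op_norm (x i j) * norm (v j) \<le> op_norm (x i j) * 1"
      using v1 onorm_pos_le[OF bounded_linear_matvec, of "x i j"]
      by (intro mult_left_mono) (auto simp: op_norm_def)
    then show "norm (x i j *v v j) \<le> op_norm (x i j)"
      using onorm[OF bounded_linear_matvec, of "x i j" "v j"] by (simp add: op_norm_def)
  qed
  show "sqrt (\<Sum>i<k. (norm (\<Sum>j<k. x i j *v v j))\<^sup>2) \<le> sqrt (\<Sum>i<k. (\<Sum>j<k. op_norm (x i j))\<^sup>2)"
    by (intro real_sqrt_le_mono sum_mono power_mono * norm_ge_zero)
qed

lemma amp_norm_1: "amp_norm 1 (\<lambda>i j. a) = op_norm a"
proof -
  have "amp_norm 1 (\<lambda>i j. a) = Sup {norm (a *v v) | v. norm v \<le> 1}"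
  proof -
    have "{sqrt (\<Sum>i<(1::nat). (norm (\<Sum>j<(1::nat). a *v v j))\<^sup>2) | v. (\<Sum>j<(1::nat). (norm (v j))\<^sup>2) \<le> 1}
        = {norm (a *v v) | v. norm v \<le> 1}"
      by (auto simp: power_le_one_iff intro: exI[of _ "\<lambda>_. v" for v])
    then show ?thesis by (simp add: amp_norm_def)
  qed
  also have "\<dots> = op_norm a"
  proof (rule cSup_eq_non_empty)
    show "{norm (a *v v) | v. norm v \<le> 1} \<noteq> {}" by (auto intro: exI[of _ 0])
  next
    fix r assume "r \<in> {norm (a *v v) | v. norm v \<le> 1}"
    then obtain v where r: "r = norm (a *v v)" and v: "norm v \<le> 1" by blast
    have "norm (a *v v) \<le> op_norm a * norm v"
      using onorm[OF bounded_linear_matvec] by (simp add: op_norm_def)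
    also have "\<dots> \<le> op_norm a * 1"
      using v onorm_pos_le[OF bounded_linear_matvec, of a]
      by (intro mult_left_mono) (auto simp: op_norm_def)
    finally show "r \<le> op_norm a" by (simp add: r)
  next
    fix b assume b: "\<And>r. r \<in> {norm (a *v v) | v. norm v \<le> 1} \<Longrightarrow> r \<le> b"
    show "op_norm a \<le> b" unfolding op_norm_def
    proof (rule onorm_le)
      fix v :: "complex^'a"
      interpret bounded_linear "\<lambda>v. a *v v" by (rule bounded_linear_matvec)
      show "norm (a *v v) \<le> b * norm v"
      proof (cases "v = 0")
        case False
        have "norm (a *v ((1 / norm v) *\<^sub>R v)) \<le> b"
          by (rule b, rule CollectI, rule exI[of _ "(1 / norm v) *\<^sub>R v"]) (simp add: False)
        then show ?thesis using False by (simp add: scaleR divide_simps)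
      qed (simp add: zero)
    qed
  qed
  finally show ?thesis .
qed

definition unital_subalgebra :: "(complex^'n^'n) set \<Rightarrow> bool" where
  "unital_subalgebra A \<longleftrightarrow>
     mat 1 \<in> A \<and>
     (\<forall>a\<in>A. \<forall>b\<in>A. a + b \<in> A \<and> a ** b \<in> A) \<and>
     (\<forall>c. \<forall>a\<in>A. map_matrix ((*) c) a \<in> A)"

definition commutative_unital_subalgebra :: "(complex^'n^'n) set \<Rightarrow> bool" where
  "commutative_unital_subalgebra A \<longleftrightarrow>
     unital_subalgebra A \<and> (\<forall>a\<in>A. \<forall>b\<in>A. a ** b = b ** a)"

definition unital_algebra_hom ::
  "(complex^'n^'n) set \<Rightarrow> (complex^'m^'m) set \<Rightarrow> (complex^'n^'n \<Rightarrow> complex^'m^'m) \<Rightarrow> bool" where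
  "unital_algebra_hom A B f \<longleftrightarrow>
     f ` A \<subseteq> B \<and>
     f (mat 1) = mat 1 \<and>
     (\<forall>a\<in>A. \<forall>b\<in>A. f (a + b) = f a + f b \<and> f (a ** b) = f a ** f b) \<and>
     (\<forall>c. \<forall>a\<in>A. f (map_matrix ((*) c) a) = map_matrix ((*) c) (f a))"

definition completely_bounded_on ::
  "(complex^'n^'n) set \<Rightarrow> (complex^'n^'n \<Rightarrow> complex^'m^'m) \<Rightarrow> bool" where
  "completely_bounded_on A f \<longleftrightarrow>
     (\<exists>K. \<forall>k x. (\<forall>i<k. \<forall>j<k. x i j \<in> A) \<longrightarrow>
        amp_norm k (\<lambda>i j. f (x i j)) \<le> K * amp_norm k x)"

definition unital_cb_isomorphism ::
  "(complex^'n^'n) set \<Rightarrow> (complex^'m^'m) set \<Rightarrow> (complex^'n^'n \<Rightarrow> complex^'m^'m) \<Rightarrow> bool" where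
  "unital_cb_isomorphism A B f \<longleftrightarrow>
     unital_subalgebra A \<and> unital_subalgebra B \<and>
     unital_algebra_hom A B f \<and> bij_betw f A B \<and>
     completely_bounded_on A f \<and> completely_bounded_on B (inv_into A f)"

definition row_space :: "(complex^2^2) set" where
  "row_space = {vector [vector [z1, z2], vector [0, 0]] | z1 z2. True}"

definition diag_space :: "(complex^2^2) set" where
  "diag_space = {vector [vector [z1, 0], vector [0, z2]] | z1 z2. True}"

definition block :: "complex \<Rightarrow> complex^2^2 \<Rightarrow> complex^4^4" where
  "block l s = vector
     [vector [l, 0, s$1$1, s$1$2],
      vector [0, l, s$2$1, s$2$2],
      vector [0, 0, l,     0    ],
      vector [0, 0, 0,     l    ]]"

definition block_algebra :: "(complex^2^2) set \<Rightarrow> (complex^4^4) set" where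
  "block_algebra S = {block l s | l s. s \<in> S}"

definition corner :: "complex^4^4 \<Rightarrow> complex^2^2" where
  "corner a = vector [vector [a$1$3, a$1$4], vector [a$2$3, a$2$4]]"

text \<open>Only the values of \<open>psi\<close> on \<open>row_space\<close> and of \<open>Psi\<close> on \<open>block_algebra row_space\<close> matter;
  there they are characterised by \<open>psi_row\<close> and \<open>Psi_block\<close> below.\<close>

definition psi :: "complex^2^2 \<Rightarrow> complex^2^2" where
  "psi s = vector [vector [s$1$1, 0], vector [0, s$1$2]]"

definition Psi :: "complex^4^4 \<Rightarrow> complex^4^4" where
  "Psi a = block (a$1$1) (psi (corner a))"

lemma vector_4:
  "(vector [w, x, y, z] :: 'a::zero^4) $ 1 = w"
  "(vector [w, x, y, z] :: 'a::zero^4) $ 2 = x"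
  "(vector [w, x, y, z] :: 'a::zero^4) $ 3 = y"
  "(vector [w, x, y, z] :: 'a::zero^4) $ 4 = z"
  by (simp_all add: vector_def)

lemma psi_row: "psi (vector [vector [z1, z2], vector [0, 0]]) = vector [vector [z1, 0], vector [0, z2]]"
  by (simp add: psi_def)

lemma Psi_block: "Psi (block l s) = block l (psi s)"
proof -
  have "corner (block l s) = s"
    by (simp add: vec_eq_iff forall_2 corner_def block_def vector_4)
  then show ?thesis by (simp add: Psi_def block_def vector_4)
qed

end

theory Submission
  imports Defs
begin

text \<open>
  Complete boundedness is a matter of dimension only. A complex-linear map between matrix algebras
  is a finite sum of sandwiches \<open>a \<mapsto> L ** a ** R\<close> (\<open>linear_map_as_sandwiches\<close>), and a
  sandwich is completely bounded because \<open>L\<close> and \<open>R\<close> act entrywise on the direct sums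
  (\<open>amp_norm_sandwich\<close>). The map \<^const>\<open>Psi\<close> is linear, and its inverse is the restriction of a
  linear map.

  The second claim already fails on the nilpotent elements, those with \<open>\<lambda> = 0\<close>, by comparison of
  two norms. The operator norm is dominated by the Frobenius norm, with equality exactly for the
  matrices of rank at most one (\<open>op_norm_le_norm\<close>, \<open>op_norm_rank_one\<close>,
  \<open>rank_one_if_op_norm_eq_norm\<close>), and the Frobenius norm satisfies the parallelogram law. Conjugation
  preserves the rank. On the row side all nilpotent elements \<open>r z1 z2\<close> have rank at most one, so
  the operator norm of \<open>F z1 z2 = X (r z1 z2) X\<inverse>\<close> obeys the parallelogram law.
  If \<open>X\<close> and \<open>Y\<close> equalised the norms, the same law would hold for the operator norm of
  \<open>G z1 z2 = Y (d z1 z2) Y\<inverse>\<close>, where \<open>d z1 z2\<close> is the diagonal counterpart. Now \<open>G 1 0\<close> and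
  \<open>G 0 1\<close> have rank one, so that both norms agree on them, and the two parallelogram laws give
  both norms the same sum of squares over \<open>G 1 1\<close> and \<open>G 1 (-1)\<close>. Since one norm
  dominates the other, they agree on \<open>G 1 1\<close>, which therefore has rank at most one. But
  \<open>d 1 1\<close> has rank two.
\<close>

section \<open>Complex-linear maps between matrix algebras are completely bounded\<close>

lemma amp_norm_L2:
  "amp_norm k x = Sup {L2_set (\<lambda>i. norm (\<Sum>j<k. x i j *v v j)) {..<k} | v.
     (\<Sum>j<k. (norm (v j))\<^sup>2) \<le> 1}"
  unfolding amp_norm_def L2_set_def ..

lemma amp_norm_least:
  fixes x :: "nat \<Rightarrow> nat \<Rightarrow> complex^'n^'n"
  assumes "\<And>v. L2_set (\<lambda>j. norm (v j)) {..<k} \<le> 1 \<Longrightarrow>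
    L2_set (\<lambda>i. norm (\<Sum>j<k. x i j *v v j)) {..<k} \<le> c"
  shows "amp_norm k x \<le> c"
  unfolding amp_norm_L2
proof (rule cSup_least)
  show "{L2_set (\<lambda>i. norm (\<Sum>j<k. x i j *v v j)) {..<k} | v.
     (\<Sum>j<k. (norm (v j))\<^sup>2) \<le> 1} \<noteq> {}"
    by (auto intro!: exI[of _ "\<lambda>_. 0"])
next
  fix r assume "r \<in> {L2_set (\<lambda>i. norm (\<Sum>j<k. x i j *v v j)) {..<k} | v.
     (\<Sum>j<k. (norm (v j))\<^sup>2) \<le> 1}"
  then show "r \<le> c" using assms by (auto simp: L2_set_def)
qed

lemma amp_norm_upper:
  fixes x :: "nat \<Rightarrow> nat \<Rightarrow> complex^'n^'n"
  assumes "L2_set (\<lambda>j. norm (v j)) {..<k} \<le> 1"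
  shows "L2_set (\<lambda>i. norm (\<Sum>j<k. x i j *v v j)) {..<k} \<le> amp_norm k x"
  unfolding amp_norm_L2
proof (rule cSup_upper)
  show "bdd_above {L2_set (\<lambda>i. norm (\<Sum>j<k. x i j *v v j)) {..<k} | v.
     (\<Sum>j<k. (norm (v j))\<^sup>2) \<le> 1}"
    using amp_norm_bdd_above[where x = x and k = k] by (simp add: L2_set_def)
qed (use assms in \<open>auto simp: L2_set_def\<close>)

lemma amp_norm_nonneg: "0 \<le> amp_norm k x"
  by (rule order_trans[OF L2_set_nonneg amp_norm_upper[where v = "\<lambda>_. 0"]]) (simp add: L2_set_def)

text \<open>The supremum over the unit ball bounds all tuples by homogeneity.\<close>

lemma amp_norm_apply:
  fixes x :: "nat \<Rightarrow> nat \<Rightarrow> complex^'n^'n"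
  shows "L2_set (\<lambda>i. norm (\<Sum>j<k. x i j *v v j)) {..<k}
    \<le> amp_norm k x * L2_set (\<lambda>j. norm (v j)) {..<k}"
proof (cases "L2_set (\<lambda>j. norm (v j)) {..<k} = 0")
  case True
  then show ?thesis by (simp add: L2_set_eq_0_iff L2_set_0')
next
  case False
  define t where "t = L2_set (\<lambda>j. norm (v j)) {..<k}"
  have t: "t > 0" using False by (simp add: t_def order_less_le)
  have "L2_set (\<lambda>i. norm (\<Sum>j<k. x i j *v ((1 / t) *\<^sub>R v j))) {..<k} \<le> amp_norm k x"
    by (rule amp_norm_upper) (use t in \<open>simp add: divide_inverse mult.commute[of _ "inverse t"] t_def[symmetric] flip: L2_set_right_distrib\<close>)
  moreover have "(\<Sum>j<k. x i j *v ((1 / t) *\<^sub>R v j)) = (1 / t) *\<^sub>R (\<Sum>j<k. x i j *v v j)" for i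
    by (simp add: linear_scale[OF matrix_vector_mul_linear] scaleR_sum_right)
  ultimately have "(1 / t) * L2_set (\<lambda>i. norm (\<Sum>j<k. x i j *v v j)) {..<k} \<le> amp_norm k x"
    using t by (simp add: L2_set_right_distrib divide_inverse)
  with t show ?thesis by (simp add: t_def[symmetric] field_simps)
qed

lemma amp_norm_sum:
  fixes y :: "'b \<Rightarrow> nat \<Rightarrow> nat \<Rightarrow> complex^'n^'n"
  assumes "finite M"
  shows "amp_norm k (\<lambda>i j. \<Sum>m\<in>M. y m i j) \<le> (\<Sum>m\<in>M. amp_norm k (y m))"
  using assms
proof induction
  case empty
  show ?case by (rule amp_norm_least) (simp add: L2_set_def)
next
  case (insert m M)
  have "amp_norm k (\<lambda>i j. y m i j + (\<Sum>m\<in>M. y m i j))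
    \<le> amp_norm k (y m) + amp_norm k (\<lambda>i j. \<Sum>m\<in>M. y m i j)"
  proof (rule amp_norm_least)
    fix v :: "nat \<Rightarrow> complex^'n"
    assume v: "L2_set (\<lambda>j. norm (v j)) {..<k} \<le> 1"
    have "L2_set (\<lambda>i. norm (\<Sum>j<k. (y m i j + (\<Sum>m\<in>M. y m i j)) *v v j)) {..<k}
      \<le> L2_set (\<lambda>i. norm (\<Sum>j<k. y m i j *v v j)
            + norm (\<Sum>j<k. (\<Sum>m\<in>M. y m i j) *v v j)) {..<k}"
      by (rule L2_set_mono)
        (simp_all add: matrix_vector_mult_add_rdistrib sum.distrib norm_triangle_ineq)
    also have "\<dots> \<le> L2_set (\<lambda>i. norm (\<Sum>j<k. y m i j *v v j)) {..<k}
            + L2_set (\<lambda>i. norm (\<Sum>j<k. (\<Sum>m\<in>M. y m i j) *v v j)) {..<k}"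
      by (rule L2_set_triangle_ineq)
    also have "\<dots> \<le> amp_norm k (y m) + amp_norm k (\<lambda>i j. \<Sum>m\<in>M. y m i j)"
      by (intro add_mono amp_norm_upper v)
    finally show "L2_set (\<lambda>i. norm (\<Sum>j<k. (y m i j + (\<Sum>m\<in>M. y m i j)) *v v j)) {..<k}
      \<le> amp_norm k (y m) + amp_norm k (\<lambda>i j. \<Sum>m\<in>M. y m i j)" .
  qed
  with insert show ?case by simp
qed

text \<open>The bound does not depend on \<open>k\<close>: multiplying every block by \<open>L\<close> (or by \<open>R\<close>) amounts to applying
  \<open>L\<close> (or \<open>R\<close>) in each of the \<open>k\<close> summands of the direct sum, which has the operator norm of
  a single copy.\<close>

lemma amp_norm_sandwich:
  fixes x :: "nat \<Rightarrow> nat \<Rightarrow> complex^'n^'n" and L :: "complex^'n^'m" and R :: "complex^'m^'n"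
  shows "amp_norm k (\<lambda>i j. L ** x i j ** R) \<le> onorm ((*v) L) * onorm ((*v) R) * amp_norm k x"
proof (rule amp_norm_least)
  fix v :: "nat \<Rightarrow> complex^'m"
  assume v: "L2_set (\<lambda>j. norm (v j)) {..<k} \<le> 1"
  have L0: "0 \<le> onorm ((*v) L)" and R0: "0 \<le> onorm ((*v) R)"
    by (simp_all add: onorm_pos_le)
  have "L2_set (\<lambda>i. norm (\<Sum>j<k. (L ** x i j ** R) *v v j)) {..<k}
    = L2_set (\<lambda>i. norm (L *v (\<Sum>j<k. x i j *v (R *v v j)))) {..<k}"
    by (simp add: linear_sum[OF matrix_vector_mul_linear]
        matrix_vector_mul_assoc matrix_mul_assoc)
  also have "\<dots> \<le> L2_set (\<lambda>i. onorm ((*v) L) * norm (\<Sum>j<k. x i j *v (R *v v j))) {..<k}"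
    by (intro L2_set_mono) (simp_all add: onorm)
  also have "\<dots> = onorm ((*v) L) * L2_set (\<lambda>i. norm (\<Sum>j<k. x i j *v (R *v v j))) {..<k}"
    by (simp add: L2_set_right_distrib L0)
  also have "\<dots> \<le> onorm ((*v) L) * (amp_norm k x * L2_set (\<lambda>j. norm (R *v v j)) {..<k})"
    by (intro mult_left_mono amp_norm_apply L0)
  also have "\<dots> \<le> onorm ((*v) L) * (amp_norm k x * L2_set (\<lambda>j. onorm ((*v) R) * norm (v j)) {..<k})"
    by (intro mult_left_mono L2_set_mono L0 amp_norm_nonneg) (simp_all add: onorm)
  also have "\<dots> = onorm ((*v) L) * onorm ((*v) R) * amp_norm k x * L2_set (\<lambda>j. norm (v j)) {..<k}"
    by (simp add: R0 flip: L2_set_right_distrib)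
  also have "\<dots> \<le> onorm ((*v) L) * onorm ((*v) R) * amp_norm k x"
    using mult_left_mono[OF v, of "onorm ((*v) L) * onorm ((*v) R) * amp_norm k x"]
    by (simp add: L0 R0 amp_norm_nonneg)
  finally show "L2_set (\<lambda>i. norm (\<Sum>j<k. (L ** x i j ** R) *v v j)) {..<k}
    \<le> onorm ((*v) L) * onorm ((*v) R) * amp_norm k x" .
qed

text \<open>Expand \<open>a\<close> in the matrix units \<open>E p q\<close>. The term \<open>a $ p $ q\<close> times \<open>f (E p q)\<close> is produced one row
  at a time: \<open>L\<close> moves row \<open>p\<close> of \<open>a\<close> to row \<open>r\<close>, and \<open>R\<close> picks out column \<open>q\<close> and multiplies it
  by row \<open>r\<close> of \<open>f (E p q)\<close>.\<close>

lemma linear_map_as_sandwiches: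
  fixes f :: "complex^'n^'n \<Rightarrow> complex^'m^'m"
  assumes add: "\<And>a b. f (a + b) = f a + f b"
    and scale: "\<And>c a. f (map_matrix ((*) c) a) = map_matrix ((*) c) (f a)"
  shows "\<exists>(L :: ('n \<times> 'n) \<times> 'm \<Rightarrow> complex^'n^'m) (R :: ('n \<times> 'n) \<times> 'm \<Rightarrow> complex^'m^'n).
    \<forall>a. f a = (\<Sum>m\<in>UNIV. L m ** a ** R m)"
proof -
  define E :: "'n \<Rightarrow> 'n \<Rightarrow> complex^'n^'n" where "E p q = (\<chi> i j. if i = p \<and> j = q then 1 else 0)" for p q
  define L :: "('n \<times> 'n) \<times> 'm \<Rightarrow> complex^'n^'m" where
    "L = (\<lambda>((p, q), r). \<chi> i j. if i = r \<and> j = p then 1 else 0)"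
  define R :: "('n \<times> 'n) \<times> 'm \<Rightarrow> complex^'m^'n" where
    "R = (\<lambda>((p, q), r). \<chi> i j. if i = q then f (E p q) $ r $ j else 0)"
  have f0: "f 0 = 0" using add[of 0 0] by simp
  have f_sum: "f (\<Sum>m\<in>M. g m) = (\<Sum>m\<in>M. f (g m))" for M and g :: "'n \<times> 'n \<Rightarrow> complex^'n^'n"
    using sum_comp_morphism[of f g M, OF f0 add] by (simp add: comp_def)
  have "f a = (\<Sum>m\<in>UNIV. L m ** a ** R m)" for a
  proof -
    have entry: "map_matrix ((*) (a $ p $ q)) (f (E p q)) = (\<Sum>r\<in>UNIV. L ((p, q), r) ** a ** R ((p, q), r))" for p q
    proof -
      have "(L ((p, q), r) ** a) $ i $ l = (if i = r then a $ p $ l else 0)" for i l r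
      proof -
        have "(L ((p, q), r) ** a) $ i $ l = (\<Sum>m\<in>UNIV. if m = p then (if i = r then a $ m $ l else 0) else 0)"
          unfolding matrix_matrix_mult_def vec_lambda_beta by (rule sum.cong) (simp_all add: L_def)
        then show ?thesis by simp
      qed
      moreover have "(b ** R ((p, q), r)) $ i $ j = b $ i $ q * f (E p q) $ r $ j" for b :: "complex^'n^'m" and i j r
      proof -
        have "(b ** R ((p, q), r)) $ i $ j = (\<Sum>m\<in>UNIV. if m = q then b $ i $ m * f (E p q) $ r $ j else 0)"
          unfolding matrix_matrix_mult_def vec_lambda_beta by (rule sum.cong) (simp_all add: R_def)
        then show ?thesis by simp
      qed
      ultimately have "(L ((p, q), r) ** a ** R ((p, q), r)) $ i $ j =
          (if i = r then a $ p $ q * f (E p q) $ i $ j else 0)" for i j r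
        by simp
      then show ?thesis by (simp add: vec_eq_iff)
    qed
    have "(\<Sum>p\<in>UNIV. \<Sum>q\<in>UNIV. a $ p $ q * E p q $ i $ j) = a $ i $ j" for i j
    proof -
      have "(\<Sum>q\<in>UNIV. a $ p $ q * E p q $ i $ j) = (if i = p then a $ p $ j else 0)" for p
        by (simp add: E_def if_distrib[of "(*) c" for c] cong: if_cong)
      then show ?thesis by simp
    qed
    then have "(\<Sum>(p, q)\<in>UNIV. map_matrix ((*) (a $ p $ q)) (E p q)) = a"
      by (simp add: vec_eq_iff sum.cartesian_product case_prod_unfold)
    then have "f a = f (\<Sum>(p, q)\<in>UNIV. map_matrix ((*) (a $ p $ q)) (E p q))"
      by simp
    also have "\<dots> = (\<Sum>(p, q)\<in>UNIV. map_matrix ((*) (a $ p $ q)) (f (E p q)))"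
      by (simp add: f_sum scale case_prod_unfold)
    also have "\<dots> = (\<Sum>(p, q)\<in>UNIV. \<Sum>r\<in>UNIV. L ((p, q), r) ** a ** R ((p, q), r))"
      by (simp add: entry)
    also have "\<dots> = (\<Sum>m\<in>UNIV. L m ** a ** R m)"
      by (simp add: sum.cartesian_product case_prod_unfold)
    finally show ?thesis .
  qed
  then show ?thesis by blast
qed

lemma completely_bounded_on_linear:
  fixes f :: "complex^'n^'n \<Rightarrow> complex^'m^'m"
  assumes "\<And>a b. f (a + b) = f a + f b"
    and "\<And>c a. f (map_matrix ((*) c) a) = map_matrix ((*) c) (f a)"
  shows "completely_bounded_on A f"
proof -
  obtain L :: "('n \<times> 'n) \<times> 'm \<Rightarrow> complex^'n^'m" and R :: "('n \<times> 'n) \<times> 'm \<Rightarrow> complex^'m^'n"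
    where f: "\<And>a. f a = (\<Sum>m\<in>UNIV. L m ** a ** R m)"
    using linear_map_as_sandwiches[of f, OF assms] by blast
  have "amp_norm k (\<lambda>i j. f (x i j)) \<le> (\<Sum>m\<in>UNIV. onorm ((*v) (L m)) * onorm ((*v) (R m))) * amp_norm k x" for k x
  proof -
    have "amp_norm k (\<lambda>i j. f (x i j)) \<le> (\<Sum>m\<in>UNIV. amp_norm k (\<lambda>i j. L m ** x i j ** R m))"
      unfolding f by (rule amp_norm_sum) simp
    also have "\<dots> \<le> (\<Sum>m\<in>UNIV. onorm ((*v) (L m)) * onorm ((*v) (R m)) * amp_norm k x)"
      by (intro sum_mono amp_norm_sandwich)
    finally show ?thesis by (simp add: sum_distrib_right)
  qed
  then show ?thesis unfolding completely_bounded_on_def by blast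
qed

lemma completely_bounded_on_cong:
  assumes "\<And>a. a \<in> A \<Longrightarrow> f a = g a"
  shows "completely_bounded_on A f \<longleftrightarrow> completely_bounded_on A g"
proof -
  have "amp_norm k (\<lambda>i j. f (x i j)) = amp_norm k (\<lambda>i j. g (x i j))"
    if "\<forall>i<k. \<forall>j<k. x i j \<in> A" for k x
  proof -
    have "L2_set (\<lambda>i. norm (\<Sum>j<k. f (x i j) *v v j)) {..<k}
        = L2_set (\<lambda>i. norm (\<Sum>j<k. g (x i j) *v v j)) {..<k}" for v
      by (rule L2_set_cong) (use that assms in \<open>auto intro!: arg_cong[where f = norm] sum.cong\<close>)
    then show ?thesis by (simp add: amp_norm_L2)
  qed
  then show ?thesis unfolding completely_bounded_on_def by (intro ex_cong1 all_cong1 imp_cong refl) simp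
qed

section \<open>The algebras and the isomorphism\<close>

lemma block_one: "block 1 0 = mat 1"
  by (simp add: block_def vec_eq_iff forall_4 vector_4 mat_def)

lemma block_add: "block l s + block l' s' = block (l + l') (s + s')"
  by (simp add: block_def vec_eq_iff forall_4 vector_4)

lemma block_scale: "map_matrix ((*) c) (block l s) = block (c * l) (map_matrix ((*) c) s)"
  by (simp add: block_def vec_eq_iff forall_4 vector_4)

lemma block_mult:
  "block l s ** block l' s' = block (l * l') (map_matrix ((*) l) s' + map_matrix ((*) l') s)"
  by (simp add: block_def vec_eq_iff forall_4 vector_4 matrix_matrix_mult_def sum_4)

lemma block_in_algebra: "s \<in> S \<Longrightarrow> block l s \<in> block_algebra S"
  by (auto simp: block_algebra_def)

lemma commutative_unital_block_algebra:
  assumes "0 \<in> S" and "\<And>s t. s \<in> S \<Longrightarrow> t \<in> S \<Longrightarrow> s + t \<in> S"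
    and "\<And>c s. s \<in> S \<Longrightarrow> map_matrix ((*) c) s \<in> S"
  shows "commutative_unital_subalgebra (block_algebra S)"
proof -
  have one: "mat 1 \<in> block_algebra S"
    using block_in_algebra[OF assms(1), of 1] by (simp add: block_one)
  have ops: "a + b \<in> block_algebra S" "a ** b \<in> block_algebra S"
      "map_matrix ((*) c) a \<in> block_algebra S" "a ** b = b ** a"
    if ab: "a \<in> block_algebra S" "b \<in> block_algebra S" for a b c
  proof -
    from ab obtain l s m t where [simp]: "a = block l s" "b = block m t" and st: "s \<in> S" "t \<in> S"
      by (auto simp: block_algebra_def)
    show "a + b \<in> block_algebra S" "a ** b \<in> block_algebra S"
      "map_matrix ((*) c) a \<in> block_algebra S"
      by (simp_all add: block_add block_mult block_scale block_in_algebra assms st)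
    show "a ** b = b ** a" by (simp add: block_mult add.commute mult.commute)
  qed
  show ?thesis
    unfolding commutative_unital_subalgebra_def unital_subalgebra_def
    by (intro conjI ballI allI) (assumption | rule one ops)+
qed

lemma row_space_iff: "s \<in> row_space \<longleftrightarrow> s$2$1 = 0 \<and> s$2$2 = 0"
  by (auto simp: row_space_def vec_eq_iff forall_2)

lemma diag_space_iff: "s \<in> diag_space \<longleftrightarrow> s$1$2 = 0 \<and> s$2$1 = 0"
  by (auto simp: diag_space_def vec_eq_iff forall_2)

lemma commutative_unital_row: "commutative_unital_subalgebra (block_algebra row_space)"
  by (rule commutative_unital_block_algebra) (auto simp: row_space_iff)

lemma commutative_unital_diag: "commutative_unital_subalgebra (block_algebra diag_space)"
  by (rule commutative_unital_block_algebra) (auto simp: diag_space_iff)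

text \<open>A linear extension of the inverse of \<^const>\<open>Psi\<close> to all matrices, so that
  \<open>completely_bounded_on_linear\<close> applies to the inverse as well.\<close>

definition Psi_back :: "complex^4^4 \<Rightarrow> complex^4^4" where
  "Psi_back b = block (b$1$1) (vector [vector [b$1$3, b$2$4], vector [0, 0]])"

lemma Psi_back_block: "Psi_back (block l s) = block l (vector [vector [s$1$1, s$2$2], vector [0, 0]])"
  by (simp add: Psi_back_def block_def vector_4)

lemma Psi_back_Psi: "a \<in> block_algebra row_space \<Longrightarrow> Psi_back (Psi a) = a"
  by (auto simp: block_algebra_def row_space_def Psi_block psi_row Psi_back_block)

lemma Psi_Psi_back: "b \<in> block_algebra diag_space \<Longrightarrow> Psi (Psi_back b) = b"
  by (auto simp: block_algebra_def diag_space_def Psi_block psi_row Psi_back_block)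

lemma Psi_add: "Psi (a + b) = Psi a + Psi b"
  by (simp add: Psi_def psi_def corner_def block_def vector_4 vec_eq_iff forall_4)

lemma Psi_scale: "Psi (map_matrix ((*) c) a) = map_matrix ((*) c) (Psi a)"
  by (simp add: Psi_def psi_def corner_def block_def vector_4 vec_eq_iff forall_4)

lemma Psi_back_add: "Psi_back (a + b) = Psi_back a + Psi_back b"
  by (simp add: Psi_back_def block_def vector_4 vec_eq_iff forall_4)

lemma Psi_back_scale: "Psi_back (map_matrix ((*) c) a) = map_matrix ((*) c) (Psi_back a)"
  by (simp add: Psi_back_def block_def vector_4 vec_eq_iff forall_4)

lemma Psi_back_in: "b \<in> block_algebra diag_space \<Longrightarrow> Psi_back b \<in> block_algebra row_space"
  by (auto simp: block_algebra_def[of diag_space] Psi_back_block row_space_iff intro!: block_in_algebra)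

lemma bij_betw_Psi: "bij_betw Psi (block_algebra row_space) (block_algebra diag_space)"
proof (rule bij_betw_byWitness[where f' = Psi_back])
  show "Psi ` block_algebra row_space \<subseteq> block_algebra diag_space"
    by (auto simp: block_algebra_def[of row_space] Psi_block psi_def diag_space_iff intro!: block_in_algebra)
  show "Psi_back ` block_algebra diag_space \<subseteq> block_algebra row_space"
    by (auto intro: Psi_back_in)
qed (simp_all add: Psi_back_Psi Psi_Psi_back)

lemma Psi_block_mult: "Psi (block l s ** block m t) = Psi (block l s) ** Psi (block m t)"
proof -
  have "psi (map_matrix ((*) l) t + map_matrix ((*) m) s)
      = map_matrix ((*) l) (psi t) + map_matrix ((*) m) (psi s)"
    by (simp add: psi_def vec_eq_iff forall_2)
  then show ?thesis by (simp add: Psi_block block_mult)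
qed

lemma Psi_mult:
  assumes "a \<in> block_algebra row_space" "b \<in> block_algebra row_space"
  shows "Psi (a ** b) = Psi a ** Psi b"
  using assms by (auto simp: block_algebra_def Psi_block_mult)

lemma unital_cb_isomorphism_Psi:
  "unital_cb_isomorphism (block_algebra row_space) (block_algebra diag_space) Psi"
  unfolding unital_cb_isomorphism_def
proof (intro conjI)
  show "unital_subalgebra (block_algebra row_space)" "unital_subalgebra (block_algebra diag_space)"
    using commutative_unital_row commutative_unital_diag
    by (simp_all add: commutative_unital_subalgebra_def)
  have "Psi (mat 1) = mat 1"
    by (simp add: Psi_block psi_def vec_eq_iff forall_2 flip: block_one)
      (simp add: block_def vec_eq_iff forall_4 vector_4)
  then show "unital_algebra_hom (block_algebra row_space) (block_algebra diag_space) Psi"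
    unfolding unital_algebra_hom_def
    using bij_betw_Psi by (auto simp: bij_betw_def Psi_add Psi_scale Psi_mult)
  show "bij_betw Psi (block_algebra row_space) (block_algebra diag_space)"
    by (rule bij_betw_Psi)
  show "completely_bounded_on (block_algebra row_space) Psi"
    by (rule completely_bounded_on_linear) (simp_all add: Psi_add Psi_scale)
  have "inv_into (block_algebra row_space) Psi b = Psi_back b" if "b \<in> block_algebra diag_space" for b
    using bij_betw_Psi that
    by (intro inv_into_f_eq) (auto simp: bij_betw_def Psi_Psi_back Psi_back_in)
  moreover have "completely_bounded_on (block_algebra diag_space) Psi_back"
    by (rule completely_bounded_on_linear) (simp_all add: Psi_back_add Psi_back_scale)
  ultimately show "completely_bounded_on (block_algebra diag_space)
      (inv_into (block_algebra row_space) Psi)"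
    by (simp cong: completely_bounded_on_cong)
qed

section \<open>Operator norm, Frobenius norm and rank one\<close>

definition rank_one :: "complex^'n \<Rightarrow> complex^'m \<Rightarrow> complex^'m^'n" where
  "rank_one u w = (\<chi> i j. u$i * w$j)"

lemma rank_one_nth [simp]: "rank_one u w $ i $ j = u$i * w$j"
  by (simp add: rank_one_def)

lemma rank_one_conjugate: "X ** rank_one u w ** Z = rank_one (X *v u) (w v* Z)"
proof -
  have "X ** rank_one u w = rank_one (X *v u) w"
    by (simp add: vec_eq_iff matrix_matrix_mult_def matrix_vector_mult_def sum_distrib_right mult.assoc)
  moreover have "rank_one p w ** Z = rank_one p (w v* Z)" for p
    by (simp add: vec_eq_iff matrix_matrix_mult_def vector_matrix_mult_def sum_distrib_left mult_ac)
  ultimately show ?thesis by simp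
qed

lemma norm_rank_one: "norm (rank_one u w) = norm u * norm w"
proof -
  have "norm (rank_one u w $ i) = norm (u$i) * norm w" for i
    by (simp add: norm_vec_def norm_mult L2_set_right_distrib)
  then show ?thesis by (simp add: norm_vec_def[of "rank_one u w"] norm_vec_def[of u]
        L2_set_left_distrib)
qed

text \<open>The matrix subtracted is \<open>a\<close> composed with the orthogonal projection onto the line of \<open>v\<close>, and the
  identity is Pythagoras for the Frobenius inner product. It yields both the domination of
  the operator norm and its equality case.\<close>

lemma norm_minus_rank_one:
  fixes a :: "complex^'n^'n"
  assumes v: "norm v = 1"
  shows "(norm (a - rank_one (a *v v) (\<chi> j. cnj (v$j))))\<^sup>2 = (norm a)\<^sup>2 - (norm (a *v v))\<^sup>2"
proof -
  define s where "s = a *v v"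
  have s_nth: "s $ i = (\<Sum>j\<in>UNIV. a $ i $ j * v $ j)" for i
    by (simp add: s_def matrix_vector_mult_def)
  have inner_Re: "inner x y = Re (x * cnj y)" for x y :: complex
    by (simp add: inner_complex_def)
  have "inner a (rank_one s (\<chi> j. cnj (v$j))) = (\<Sum>i\<in>UNIV. \<Sum>j\<in>UNIV. Re (cnj (s$i) * (a$i$j * v$j)))"
    by (simp add: inner_vec_def inner_Re mult_ac)
  also have "\<dots> = (\<Sum>i\<in>UNIV. Re (cnj (s$i) * s$i))"
    by (simp only: s_nth[symmetric] flip: Re_sum sum_distrib_left)
  also have "\<dots> = (norm s)\<^sup>2"
    by (simp add: power2_norm_eq_inner inner_vec_def inner_Re mult.commute)
  finally have "inner a (rank_one s (\<chi> j. cnj (v$j))) = (norm s)\<^sup>2" .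
  moreover have "norm (\<chi> j. cnj (v$j)) = 1"
    using v by (simp add: norm_vec_def)
  then have "norm (rank_one s (\<chi> j. cnj (v$j))) = norm s"
    by (simp add: norm_rank_one)
  ultimately show ?thesis
    using dot_norm_neg[of a "rank_one s (\<chi> j. cnj (v$j))"] by (simp add: s_def field_simps)
qed

text \<open>The unit sphere is compact. A maximising vector is what makes the equality case exact.\<close>

lemma op_norm_attained:
  fixes a :: "complex^'n^'n"
  obtains v where "norm v = 1" "op_norm a = norm (a *v v)"
proof -
  have "axis undefined 1 \<in> sphere (0 :: complex^'n) 1"
    by (simp add: norm_axis_1)
  then have "\<exists>v\<in>sphere (0 :: complex^'n) 1. \<forall>w\<in>sphere 0 1. norm (a *v w) \<le> norm (a *v v)"
    by (intro continuous_attains_sup continuous_intros linear_continuous_on bounded_linear_matvec) auto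
  then obtain v :: "complex^'n" where v: "norm v = 1"
    and max: "\<And>w. norm w = 1 \<Longrightarrow> norm (a *v w) \<le> norm (a *v v)"
    by auto
  have "op_norm a \<le> norm (a *v v)"
    unfolding op_norm_def
  proof (rule onorm_le)
    fix w :: "complex^'n"
    show "norm (a *v w) \<le> norm (a *v v) * norm w"
    proof (cases "w = 0")
      case False
      then have "norm (a *v ((1 / norm w) *\<^sub>R w)) \<le> norm (a *v v)"
        by (intro max) simp
      with False show ?thesis
        by (simp add: linear_scale[OF matrix_vector_mul_linear] field_simps)
    qed simp
  qed
  moreover have "norm (a *v v) \<le> op_norm a"
    using onorm[OF bounded_linear_matvec, of a v] v by (simp add: op_norm_def)
  ultimately show thesis using that v by simp
qed

lemma op_norm_le_norm: "op_norm a \<le> norm a"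
proof -
  obtain v where v: "norm v = 1" "op_norm a = norm (a *v v)" by (rule op_norm_attained)
  have "0 \<le> (norm a)\<^sup>2 - (norm (a *v v))\<^sup>2"
    unfolding norm_minus_rank_one[OF v(1), symmetric] by simp
  then show ?thesis using power2_le_imp_le[of "norm (a *v v)" "norm a"] v(2) by simp
qed

text \<open>At a maximising \<open>v\<close> the remainder in \<open>norm_minus_rank_one\<close> vanishes.\<close>

lemma rank_one_if_op_norm_eq_norm:
  assumes "op_norm a = norm a"
  obtains u w where "a = rank_one u w"
proof -
  obtain v where v: "norm v = 1" "op_norm a = norm (a *v v)" by (rule op_norm_attained)
  have "(norm (a - rank_one (a *v v) (\<chi> j. cnj (v$j))))\<^sup>2 = 0"
    using norm_minus_rank_one[OF v(1), of a] v(2) assms by simp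
  then show thesis using that by simp
qed

lemma op_norm_rank_one: "op_norm (rank_one u w) = norm u * norm w"
proof (rule antisym)
  show "op_norm (rank_one u w) \<le> norm u * norm w"
    using op_norm_le_norm[of "rank_one u w"] by (simp add: norm_rank_one)
  show "norm u * norm w \<le> op_norm (rank_one u w)"
  proof (cases "w = 0")
    case True
    then show ?thesis by (simp add: op_norm_def onorm_pos_le)
  next
    case False
    \<comment> \<open>the vector at which Cauchy-Schwarz for the functional \<open>w\<close> is sharp\<close>
    define v where "v = (\<chi> j. cnj (w$j))"
    have nv: "norm v = norm w" by (simp add: v_def norm_vec_def)
    have "(\<Sum>j\<in>UNIV. w$j * v$j) = complex_of_real ((norm w)\<^sup>2)"
      by (simp add: v_def norm_vec_def L2_set_def sum_nonneg complex_norm_square del: of_real_power)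
    moreover have "(rank_one u w *v v) $ i = u$i * (\<Sum>j\<in>UNIV. w$j * v$j)" for i
      by (simp add: matrix_vector_mult_def sum_distrib_left mult.assoc)
    ultimately have "rank_one u w *v v = (norm w)\<^sup>2 *\<^sub>R u"
      by (simp add: vec_eq_iff scaleR_conv_of_real[where 'a = complex])
    then have "(norm w)\<^sup>2 * norm u \<le> op_norm (rank_one u w) * norm w"
      using onorm[OF bounded_linear_matvec, of "rank_one u w" v] nv by (simp add: op_norm_def)
    with False show ?thesis by (simp add: power2_eq_square mult_ac)
  qed
qed

lemma conjugate_add:
  fixes a b :: "'a::ring_1^'n^'n"
  shows "X ** (a + b) ** Z = X ** a ** Z + X ** b ** Z"
  by (simp add: vec_eq_iff matrix_matrix_mult_def distrib_left distrib_right sum.distrib)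

lemma conjugate_diff:
  fixes a b :: "'a::ring_1^'n^'n"
  shows "X ** (a - b) ** Z = X ** a ** Z - X ** b ** Z"
  by (simp add: vec_eq_iff matrix_matrix_mult_def left_diff_distrib right_diff_distrib sum_subtractf)

lemma norm_parallelogram:
  fixes a b :: "'a::real_inner"
  shows "(norm (a + b))\<^sup>2 + (norm (a - b))\<^sup>2 = 2 * (norm a)\<^sup>2 + 2 * (norm b)\<^sup>2"
  by (simp add: power2_norm_eq_inner inner_simps inner_commute)

section \<open>No pair of similarities makes the isomorphism isometric\<close>

text \<open>On the pencil of conjugated row nilpotents the operator norm is Euclidean; on the diagonal pencil it
  cannot be, since that pencil is spanned by two elements of rank one and contains elements of rank
  two.\<close>

lemma no_isometric_similarities:
  fixes X Y :: "complex^4^4"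
  assumes "invertible Y"
  shows "\<exists>a\<in>block_algebra row_space.
    op_norm (X ** a ** matrix_inv X) \<noteq> op_norm (Y ** Psi a ** matrix_inv Y)"
proof (rule ccontr)
  assume contra: "\<not> ?thesis"
  have YY: "Y ** matrix_inv Y = mat 1 \<and> matrix_inv Y ** Y = mat 1"
    using assms unfolding invertible_def matrix_inv_def by (rule someI_ex)
  define r :: "complex \<Rightarrow> complex \<Rightarrow> complex^4^4" where
    "r z1 z2 = block 0 (vector [vector [z1, z2], vector [0, 0]])" for z1 z2
  define d :: "complex \<Rightarrow> complex \<Rightarrow> complex^4^4" where
    "d z1 z2 = block 0 (vector [vector [z1, 0], vector [0, z2]])" for z1 z2
  define F where "F z1 z2 = X ** r z1 z2 ** matrix_inv X" for z1 z2
  define G where "G z1 z2 = Y ** d z1 z2 ** matrix_inv Y" for z1 z2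
  have FG: "op_norm (F z1 z2) = op_norm (G z1 z2)" for z1 z2
  proof -
    have "r z1 z2 \<in> block_algebra row_space"
      by (auto simp: r_def block_algebra_def row_space_def)
    moreover have "Psi (r z1 z2) = d z1 z2"
      by (simp add: r_def d_def Psi_block psi_row)
    ultimately show ?thesis using contra by (auto simp: F_def G_def)
  qed
  have F_op: "op_norm (F z1 z2) = norm (F z1 z2)" for z1 z2
  proof -
    have "r z1 z2 = rank_one (vector [1, 0, 0, 0]) (vector [0, 0, z1, z2])"
      by (simp add: r_def block_def vec_eq_iff forall_4 vector_4)
    then show ?thesis
      unfolding F_def by (simp add: rank_one_conjugate op_norm_rank_one norm_rank_one)
  qed
  have G_op: "op_norm (G z1 z2) = norm (G z1 z2)" if "z1 = 0 \<or> z2 = 0" for z1 z2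
  proof -
    have "d z1 0 = rank_one (vector [1, 0, 0, 0]) (vector [0, 0, z1, 0])"
      "d 0 z2 = rank_one (vector [0, 1, 0, 0]) (vector [0, 0, 0, z2])"
      by (simp_all add: d_def block_def vec_eq_iff forall_4 vector_4)
    with that show ?thesis
      unfolding G_def by (auto simp: rank_one_conjugate op_norm_rank_one norm_rank_one)
  qed
  have r: "r 1 1 = r 1 0 + r 0 1" "r 1 (-1) = r 1 0 - r 0 1"
    and d: "d 1 1 = d 1 0 + d 0 1" "d 1 (-1) = d 1 0 - d 0 1"
    by (simp_all add: r_def d_def block_def vec_eq_iff forall_4 vector_4)
  have F: "F 1 1 = F 1 0 + F 0 1" "F 1 (-1) = F 1 0 - F 0 1"
    unfolding F_def by (simp_all add: r conjugate_add conjugate_diff)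
  have G: "G 1 1 = G 1 0 + G 0 1" "G 1 (-1) = G 1 0 - G 0 1"
    unfolding G_def by (simp_all add: d conjugate_add conjugate_diff)
  have "(op_norm (G 1 1))\<^sup>2 + (op_norm (G 1 (-1)))\<^sup>2 = (norm (F 1 1))\<^sup>2 + (norm (F 1 (-1)))\<^sup>2"
    by (simp add: F_op flip: FG)
  also have "\<dots> = 2 * (norm (F 1 0))\<^sup>2 + 2 * (norm (F 0 1))\<^sup>2"
    unfolding F by (rule norm_parallelogram)
  also have "\<dots> = 2 * (norm (G 1 0))\<^sup>2 + 2 * (norm (G 0 1))\<^sup>2"
    using FG[of 1 0] FG[of 0 1] by (simp add: F_op G_op)
  also have "\<dots> = (norm (G 1 1))\<^sup>2 + (norm (G 1 (-1)))\<^sup>2"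
    unfolding G by (rule norm_parallelogram[symmetric])
  finally have sum_eq: "(op_norm (G 1 1))\<^sup>2 + (op_norm (G 1 (-1)))\<^sup>2
      = (norm (G 1 1))\<^sup>2 + (norm (G 1 (-1)))\<^sup>2" .
  have op0: "0 \<le> op_norm a" for a :: "complex^4^4"
    by (simp add: op_norm_def onorm_pos_le)
  have "(op_norm (G 1 (-1)))\<^sup>2 \<le> (norm (G 1 (-1)))\<^sup>2"
    by (intro power_mono op_norm_le_norm op0)
  with sum_eq have "(norm (G 1 1))\<^sup>2 \<le> (op_norm (G 1 1))\<^sup>2" by simp
  then have "norm (G 1 1) \<le> op_norm (G 1 1)"
    by (rule power2_le_imp_le) (rule op0)
  then have "op_norm (G 1 1) = norm (G 1 1)"
    using op_norm_le_norm[of "G 1 1"] by simp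
  then obtain u w where "G 1 1 = rank_one u w"
    by (rule rank_one_if_op_norm_eq_norm)
  moreover have "d 1 1 = matrix_inv Y ** G 1 1 ** Y"
  proof -
    have "matrix_inv Y ** G 1 1 ** Y = (matrix_inv Y ** Y) ** d 1 1 ** (matrix_inv Y ** Y)"
      by (simp only: G_def matrix_mul_assoc)
    then show ?thesis by (simp add: YY)
  qed
  ultimately obtain p q where pq: "d 1 1 = rank_one p q"
    by (auto simp: rank_one_conjugate)
  \<comment> \<open>a \<open>2 \<times> 2\<close> minor of \<open>d 1 1\<close> that does not vanish\<close>
  have "p$1 * q$3 = 1" "p$2 * q$4 = 1" "p$1 * q$4 = 0"
    unfolding rank_one_nth[symmetric] pq[symmetric] by (simp_all add: d_def block_def vector_4)
  then show False by auto
qed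

theorem mainTheorem4:
  shows "commutative_unital_subalgebra (block_algebra row_space) \<and>
    commutative_unital_subalgebra (block_algebra diag_space) \<and>
    unital_cb_isomorphism (block_algebra row_space) (block_algebra diag_space) Psi \<and>
    \<not> (\<exists>(X :: complex^4^4) (Y :: complex^4^4). invertible X \<and> invertible Y \<and>
         (\<forall>a\<in>block_algebra row_space.
            op_norm (X ** a ** matrix_inv X) = op_norm (Y ** Psi a ** matrix_inv Y)))"
  using commutative_unital_row commutative_unital_diag unital_cb_isomorphism_Psi
    no_isometric_similarities by blast

end
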